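(* Let $p$ be a prime number and $n$ be a natural number, where $n\geq 4$ if $p=2$ and $n\geq 3$ if $p$ is odd. Let $G:=M_n(p)$ be the modular $p$-group of order $p^n$. Then $$\Delta(G)=\begin{cases} 2^{n-3}+1 & \text{if } p=2,\\[2pt] \dfrac{p^{n-2}+p-2}{2} & \text{if } p \text{ is odd}.\end{cases}$$
   Context: For a prime $p$ and a natural number $n$ with $n\ge 4$ if $p=2$ and $n\ge 3$ if $p$ is odd, $M_n(p):=\langle a,b\mid a^{p^{n-1}}=1=b^p,\ a^b=a^{1+p^{n-2}}\rangle$, where $a^b=b^{-1}ab$; this is the modular $p$-group of order $p^n$. A subset $S$ of a group $G$ normally generates $G$ if $G$ is the normal closure of $S$ in $G$ (the smallest normal subgroup of $G$ containing $S$). Put $\mathrm{Conj}_G(S^{\pm1})=\{h^{-1}sh\mid h\in G,\ s\in S\text{ or }s^{-1}\in S\}$. If $S$ normally generates $G$, then for $g\in G$ let $\|g\|_S$ be the least $k\in\{0,1,2,\dots\}$ such that $g$ is a product of $k$ elements of $\mathrm{Conj}_G(S^{\pm1})$ (so $\|1\|_S=0$), and let $\|G\|_S=\sup\{\|g\|_S\mid g\in G\}$. The conjugacy diameter of $G$ is $\Delta(G)=\sup\{\|G\|_S\mid S\subseteq G\text{ finite and } S \text{ normally generates } G\}$. *)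

theory Defs
  imports "HOL-Algebra.Coset" "HOL-Library.Extended_Real" "HOL-Computational_Algebra.Primes"
begin

section \<open>Groups given by generators and relations\<close>

datatype 'x letter = Gen 'x | InvGen 'x

text \<open>A pair \<open>(u, v)\<close> in \<open>R\<close> stands for the defining relation \<open>u = v\<close>. The presented group
  consists of the words in the generators and their formal inverses modulo the least congruence
  on the free monoid of words that contains \<open>R\<close> and free cancellation.\<close>

inductive pres_eq :: "('x letter list \<times> 'x letter list) set \<Rightarrow> 'x letter list \<Rightarrow> 'x letter list \<Rightarrow> bool"
  for R where
  rel: "(u, v) \<in> R \<Longrightarrow> pres_eq R u v"
| cancel_right: "pres_eq R [Gen x, InvGen x] []"
| cancel_left: "pres_eq R [InvGen x, Gen x] []"
| refl: "pres_eq R u u"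
| sym: "pres_eq R u v \<Longrightarrow> pres_eq R v u"
| trans: "pres_eq R u v \<Longrightarrow> pres_eq R v w \<Longrightarrow> pres_eq R u w"
| cong: "pres_eq R u u' \<Longrightarrow> pres_eq R v v' \<Longrightarrow> pres_eq R (u @ v) (u' @ v')"

definition word_class :: "('x letter list \<times> 'x letter list) set \<Rightarrow> 'x letter list \<Rightarrow> 'x letter list set"
  where "word_class R u = {v. pres_eq R u v}"

definition presented_group ::
    "('x letter list \<times> 'x letter list) set \<Rightarrow> 'x letter list set monoid"
  where "presented_group R =
    \<lparr>carrier = range (word_class R),
     monoid.mult = (\<lambda>A B. {w. \<exists>u\<in>A. \<exists>v\<in>B. pres_eq R (u @ v) w}),
     one = word_class R []\<rparr>"

lemma word_class_eq_iff: "word_class R u = word_class R v \<longleftrightarrow> pres_eq R u v"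
  unfolding word_class_def by (auto intro: pres_eq.refl pres_eq.sym pres_eq.trans)

lemma presented_group_mult:
  "word_class R u \<otimes>\<^bsub>presented_group R\<^esub> word_class R v = word_class R (u @ v)"
  unfolding presented_group_def word_class_def
  by (auto intro: pres_eq.refl pres_eq.trans pres_eq.cong)

lemma group_presented_group: "group (presented_group R)"
proof (rule groupI)
  have car: "carrier (presented_group R) = range (word_class R)"
    and one: "\<one>\<^bsub>presented_group R\<^esub> = word_class R []"
    by (simp_all add: presented_group_def)
  show "\<one>\<^bsub>presented_group R\<^esub> \<in> carrier (presented_group R)"
    by (simp add: car one)
  show "A \<otimes>\<^bsub>presented_group R\<^esub> B \<in> carrier (presented_group R)"
    if "A \<in> carrier (presented_group R)" "B \<in> carrier (presented_group R)" for A B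
    using that by (auto simp: car presented_group_mult)
  show "A \<otimes>\<^bsub>presented_group R\<^esub> B \<otimes>\<^bsub>presented_group R\<^esub> C
      = A \<otimes>\<^bsub>presented_group R\<^esub> (B \<otimes>\<^bsub>presented_group R\<^esub> C)"
    if "A \<in> carrier (presented_group R)" "B \<in> carrier (presented_group R)"
      "C \<in> carrier (presented_group R)" for A B C
    using that by (auto simp: car presented_group_mult)
  show "\<one>\<^bsub>presented_group R\<^esub> \<otimes>\<^bsub>presented_group R\<^esub> A = A"
    if "A \<in> carrier (presented_group R)" for A
    using that by (auto simp: car one presented_group_mult)
  have "\<exists>v. pres_eq R (v @ u) []" for u
  proof (induction u)
    case Nil
    show ?case using pres_eq.refl[of R "[]"] by auto
  next
    case (Cons l u)
    then obtain v where v: "pres_eq R (v @ u) []" by blast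
    obtain l' where l': "pres_eq R [l', l] []"
      by (cases l) (blast intro: pres_eq.cancel_left pres_eq.cancel_right)+
    have "pres_eq R (v @ [l', l] @ u) (v @ [] @ u)"
      by (intro pres_eq.cong pres_eq.refl l')
    then have "pres_eq R ((v @ [l']) @ l # u) []"
      using v by (auto intro: pres_eq.trans)
    then show ?case by blast
  qed
  then show "\<exists>B\<in>carrier (presented_group R). B \<otimes>\<^bsub>presented_group R\<^esub> A = \<one>\<^bsub>presented_group R\<^esub>"
    if "A \<in> carrier (presented_group R)" for A
    using that by (force simp: car one presented_group_mult word_class_eq_iff)
qed

section \<open>The modular $p$-group\<close>

datatype gen_ab = gen_a | gen_b

definition modular_group :: "nat \<Rightarrow> nat \<Rightarrow> gen_ab letter list set monoid"
  where "modular_group n p = presented_group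
    {(replicate (p ^ (n - 1)) (Gen gen_a), []),
     (replicate p (Gen gen_b), []),
     ([InvGen gen_b, Gen gen_a, Gen gen_b], replicate (1 + p ^ (n - 2)) (Gen gen_a))}"

section \<open>Conjugacy diameter\<close>

definition normal_closure :: "('g, 'm) monoid_scheme \<Rightarrow> 'g set \<Rightarrow> 'g set"
  where "normal_closure G S = \<Inter>{N. N \<lhd> G \<and> S \<subseteq> N}"

definition normally_generates :: "('g, 'm) monoid_scheme \<Rightarrow> 'g set \<Rightarrow> bool"
  where "normally_generates G S \<longleftrightarrow> S \<subseteq> carrier G \<and> normal_closure G S = carrier G"

definition conj_set :: "('g, 'm) monoid_scheme \<Rightarrow> 'g set \<Rightarrow> 'g set"
  where "conj_set G S =
    {inv\<^bsub>G\<^esub> h \<otimes>\<^bsub>G\<^esub> s \<otimes>\<^bsub>G\<^esub> h | h s.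
      h \<in> carrier G \<and> s \<in> carrier G \<and> (s \<in> S \<or> inv\<^bsub>G\<^esub> s \<in> S)}"

text \<open>The least length of a factorisation; it would be \<open>\<infinity>\<close> if there were none, which cannot
  happen when \<open>S\<close> normally generates \<open>G\<close>.\<close>

definition conj_norm :: "('g, 'm) monoid_scheme \<Rightarrow> 'g set \<Rightarrow> 'g \<Rightarrow> enat"
  where "conj_norm G S g =
    (INF xs \<in> {xs. set xs \<subseteq> conj_set G S \<and> foldr (\<otimes>\<^bsub>G\<^esub>) xs \<one>\<^bsub>G\<^esub> = g}. enat (length xs))"

definition group_conj_norm :: "('g, 'm) monoid_scheme \<Rightarrow> 'g set \<Rightarrow> enat"
  where "group_conj_norm G S = (SUP g \<in> carrier G. conj_norm G S g)"

definition conj_diameter :: "('g, 'm) monoid_scheme \<Rightarrow> enat"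
  where "conj_diameter G = (SUP S \<in> {S. finite S \<and> normally_generates G S}. group_conj_norm G S)"

end

theory Submission
  imports Defs "HOL-Algebra.Generated_Groups" "HOL-Number_Theory.Cong"
begin

text \<open>Put \<open>m = p ^ (n - 2)\<close>. The central element \<open>c = a\<^sup>m\<close> generates the derived subgroup, with quotient
  \<open>C\<^sub>m \<times> C\<^sub>p\<close>, and the conjugacy class of a noncentral element \<open>z\<close> is the full coset of \<open>c\<close>-multiples
  of \<open>z\<close>. Hence, apart from powers of \<open>c\<close> (which have norm at most 2), the conjugacy norm is
  the word norm in \<open>C\<^sub>m \<times> C\<^sub>p\<close>. A normally generating set contains an element \<open>x\<close> of order \<open>m\<close> in the
  quotient and an element \<open>y\<close> outside the subgroup generated by \<open>x\<close> and the \<open>p\<close>-th powers, so every element is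
  \<open>x\<^sup>i y\<^sup>j c\<^sup>k\<close> with \<open>\<bar>i\<bar> \<le> m/2\<close> and \<open>\<bar>j\<bar> \<le> p/2\<close>. For \<open>S = {a, b}\<close> the exponent sums of \<open>a\<close> modulo \<open>m\<close> and
  of \<open>b\<close> modulo \<open>p\<close> show that this bound is attained. Both parities of \<open>p\<close> give the diameter
  \<open>\<lfloor>m/2\<rfloor> + \<lfloor>p/2\<rfloor>\<close>.\<close>

section \<open>Residues of small absolute value\<close>

lemma cong_mult_solvable:
  fixes x q :: int
  assumes "\<not> [x = 0] (mod q)" "prime q"
  shows "\<exists>t. [x * t = k] (mod q)"
proof -
  have "coprime x q"
    using assms by (metis cong_0_iff coprime_commute prime_imp_coprime)
  then obtain t where "[x * t = 1] (mod q)" using cong_solve_coprime_int by blast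
  then have "[x * (t * k) = 1 * k] (mod q)"
    unfolding mult.assoc[symmetric] by (rule cong_scalar_right)
  then show ?thesis by auto
qed

text \<open>Residues above \<open>m div 2\<close> are lowered by \<open>m\<close>; for either parity
  of \<open>m\<close> the absolute value is then at most \<open>m div 2\<close>.\<close>

lemma exists_small_residue:
  fixes k :: int and m :: nat
  assumes "0 < m"
  shows "\<exists>i. [i = k] (mod int m) \<and> \<bar>i\<bar> \<le> int (m div 2)"
proof (cases "k mod int m \<le> int m div 2")
  case True
  then show ?thesis
    using assms by (intro exI[of _ "k mod int m"]) (auto simp: cong_def zdiv_int)
next
  case False
  have "k mod int m < int m" using assms by simp
  moreover have "int m \<le> 2 * (int m div 2) + 1" by presburger
  ultimately have "\<bar>k mod int m - int m\<bar> \<le> int (m div 2)"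
    using False by (simp add: zdiv_int)
  then show ?thesis
    by (intro exI[of _ "k mod int m - int m"]) (simp add: cong_def)
qed

text \<open>Going up from \<open>m div 2\<close> by a multiple of \<open>m\<close> increases the
  value; going down leaves an absolute value of at least \<open>m - m div 2\<close>, which is no
  less than \<open>m div 2\<close>.\<close>

lemma le_abs_if_cong_half:
  fixes i :: int and m :: nat
  assumes "[i = int (m div 2)] (mod int m)"
  shows "int (m div 2) \<le> \<bar>i\<bar>"
proof -
  obtain q where q: "i = int (m div 2) + int m * q"
    using assms by (metis cong_iff_lin cong_sym)
  have h: "2 * int (m div 2) \<le> int m" by simp
  consider "q = 0" | "q \<ge> 1" | "q \<le> - 1" by linarith
  then show ?thesis
  proof cases
    case 2
    then have "int m * q \<ge> 0" by simp
    with q show ?thesis by linarith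
  next
    case 3
    then have "int m * q \<le> int m * (- 1)" by (intro mult_left_mono) auto
    with q h show ?thesis by linarith
  qed (simp add: q)
qed

section \<open>Conjugation and additive functions on a group\<close>

context group
begin

lemma conj_mult:
  assumes "h \<in> carrier G" "x \<in> carrier G" "y \<in> carrier G"
  shows "inv h \<otimes> (x \<otimes> y) \<otimes> h = (inv h \<otimes> x \<otimes> h) \<otimes> (inv h \<otimes> y \<otimes> h)"
  using assms by (simp add: m_assoc inv_solve_left flip: m_assoc[of h "inv h"])

lemma conj_int_pow:
  assumes "h \<in> carrier G" "x \<in> carrier G"
  shows "inv h \<otimes> x [^] (i::int) \<otimes> h = (inv h \<otimes> x \<otimes> h) [^] i"
proof -
  interpret c: group_hom G G "\<lambda>x. inv h \<otimes> x \<otimes> h"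
    by (unfold_locales, rule homI) (use assms in \<open>auto simp: conj_mult\<close>)
  show ?thesis using assms(2) by (rule c.hom_int_pow)
qed

lemma conj_eq_iff:
  assumes "x \<in> carrier G" "h \<in> carrier G" "y \<in> carrier G"
  shows "inv h \<otimes> x \<otimes> h = y \<longleftrightarrow> x \<otimes> h = h \<otimes> y"
proof -
  have "inv h \<otimes> x \<otimes> h = inv h \<otimes> (x \<otimes> h)" using assms by (simp add: m_assoc)
  then show ?thesis using assms inv_solve_left[of y h "x \<otimes> h"] by auto
qed

text \<open>Commuting with \<open>y\<close> means being fixed under conjugation by \<open>y\<close>,
  and conjugation respects powers.\<close>

lemma commute_int_pow:
  assumes "x \<in> carrier G" "y \<in> carrier G" "x \<otimes> y = y \<otimes> x"
  shows "x [^] (i::int) \<otimes> y = y \<otimes> x [^] i"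
  using assms by (simp flip: conj_eq_iff add: conj_int_pow)

lemma foldr_mult_closed:
  "set xs \<subseteq> carrier G \<Longrightarrow> foldr (\<otimes>) xs \<one> \<in> carrier G"
  by (induction xs) auto

lemma foldr_replicate_mult:
  assumes "x \<in> carrier G" "g \<in> carrier G"
  shows "foldr (\<otimes>) (replicate k x) g = x [^] k \<otimes> g"
proof (induction k)
  case (Suc k)
  have "x \<otimes> (x [^] k \<otimes> g) = x [^] Suc k \<otimes> g"
    unfolding nat_pow_Suc2[OF assms(1)] using assms by (simp add: m_assoc)
  with Suc show ?case by simp
qed (use assms in simp)

section \<open>Homomorphisms into cyclic groups\<close>

text \<open>A homomorphism into the integers modulo \<open>k\<close>, given by an integer-valued
  lift so that exponents remain integers, which have absolute values.\<close>

definition additive_mod :: "int \<Rightarrow> ('a \<Rightarrow> int) \<Rightarrow> bool" where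
  "additive_mod k f \<longleftrightarrow> (\<forall>x\<in>carrier G. \<forall>y\<in>carrier G. [f (x \<otimes> y) = f x + f y] (mod k))"

lemma additive_mod_mult:
  "\<lbrakk>additive_mod k f; x \<in> carrier G; y \<in> carrier G\<rbrakk> \<Longrightarrow> [f (x \<otimes> y) = f x + f y] (mod k)"
  by (simp add: additive_mod_def)

lemma additive_mod_one:
  assumes "additive_mod k f" shows "[f \<one> = 0] (mod k)"
  using additive_mod_mult[OF assms one_closed one_closed]
  by (simp add: cong_iff_dvd_diff)

lemma additive_mod_inv:
  assumes "additive_mod k f" "x \<in> carrier G" shows "[f (inv x) = - f x] (mod k)"
proof -
  have "[f x + f (inv x) = 0] (mod k)"
    using additive_mod_mult[of k f x "inv x"] additive_mod_one[of k f] assms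
    by (auto simp: cong_def)
  then show ?thesis by (simp add: cong_iff_dvd_diff add.commute)
qed

lemma additive_mod_nat_pow:
  assumes "additive_mod k f" "x \<in> carrier G" shows "[f (x [^] (i::nat)) = int i * f x] (mod k)"
proof (induction i)
  case 0
  then show ?case using additive_mod_one[OF assms(1)] by simp
next
  case (Suc i)
  have "[f (x [^] Suc i) = f (x [^] i) + f x] (mod k)"
    using additive_mod_mult[OF assms(1)] assms(2) by simp
  also have "[f (x [^] i) + f x = int i * f x + f x] (mod k)"
    using Suc by (intro cong_add) auto
  finally show ?case by (simp add: algebra_simps)
qed

lemma additive_mod_int_pow:
  assumes "additive_mod k f" "x \<in> carrier G" shows "[f (x [^] (i::int)) = i * f x] (mod k)"
proof (cases i rule: int_cases2)
  case (nonneg n)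
  then show ?thesis using additive_mod_nat_pow[OF assms, of n] by (simp add: int_pow_int)
next
  case (nonpos n)
  have "[f (inv (x [^] n)) = - (int n * f x)] (mod k)"
    using additive_mod_inv[OF assms(1), of "x [^] n"] additive_mod_nat_pow[OF assms, of n] assms(2)
    by (metis cong_minus_minus_iff cong_trans nat_pow_closed)
  then show ?thesis using nonpos assms(2) by (simp add: int_pow_neg int_pow_int)
qed

lemma additive_mod_conj:
  assumes "additive_mod k f" "x \<in> carrier G" "h \<in> carrier G"
  shows "[f (inv h \<otimes> x \<otimes> h) = f x] (mod k)"
proof -
  have "[f (inv h \<otimes> x \<otimes> h) = f (inv h \<otimes> x) + f h] (mod k)"
    using assms by (intro additive_mod_mult) auto
  also have "[f (inv h \<otimes> x) + f h = (f (inv h) + f x) + f h] (mod k)"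
    using assms by (intro cong_add additive_mod_mult) auto
  also have "[(f (inv h) + f x) + f h = (- f h + f x) + f h] (mod k)"
    using assms by (intro cong_add additive_mod_inv) auto
  finally show ?thesis by simp
qed

lemma normal_additive_kernel:
  assumes "additive_mod k f"
  shows "{x \<in> carrier G. [f x = 0] (mod k)} \<lhd> G"
proof -
  have "subgroup {x \<in> carrier G. [f x = 0] (mod k)} G"
  proof (rule subgroupI)
    show "inv x \<in> {x \<in> carrier G. [f x = 0] (mod k)}"
      if "x \<in> {x \<in> carrier G. [f x = 0] (mod k)}" for x
      using that additive_mod_inv[OF assms, of x]
      by (auto intro: cong_trans simp: cong_0_iff dest: cong_dvd_iff)
    show "x \<otimes> y \<in> {x \<in> carrier G. [f x = 0] (mod k)}"
      if "x \<in> {x \<in> carrier G. [f x = 0] (mod k)}" "y \<in> {x \<in> carrier G. [f x = 0] (mod k)}" for x y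
      using that additive_mod_mult[OF assms, of x y]
      by (auto simp: cong_0_iff dest: cong_dvd_iff)
  qed (use additive_mod_one[OF assms] in auto)
  \<comment> \<open>\<open>normal_inv_iff\<close> has the inverse on the right, so the conjugation
    lemma is applied to \<open>inv x\<close>.\<close>
  moreover have "x \<otimes> h \<otimes> inv x \<in> {x \<in> carrier G. [f x = 0] (mod k)}"
    if "x \<in> carrier G" "h \<in> {x \<in> carrier G. [f x = 0] (mod k)}" for x h
    using that additive_mod_conj[OF assms, of h "inv x"] by (auto intro: cong_trans)
  ultimately show ?thesis unfolding normal_inv_iff by blast
qed

section \<open>Normal generation and the conjugacy norm\<close>

text \<open>Otherwise the kernel of \<open>f\<close> would be a proper normal subgroup containing
  \<open>S\<close>. This is how normal generation enters the upper bound.\<close>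

lemma normally_generates_not_additive_kernel:
  assumes "normally_generates G S" "additive_mod k f" "g \<in> carrier G" "\<not> [f g = 0] (mod k)"
  shows "\<exists>s\<in>S. \<not> [f s = 0] (mod k)"
proof (rule ccontr)
  assume "\<not> ?thesis"
  with assms(1) have "S \<subseteq> {x \<in> carrier G. [f x = 0] (mod k)}"
    by (auto simp: normally_generates_def)
  then have "normal_closure G S \<subseteq> {x \<in> carrier G. [f x = 0] (mod k)}"
    unfolding normal_closure_def using normal_additive_kernel[OF assms(2)] by blast
  with assms show False by (auto simp: normally_generates_def)
qed

lemma normally_generates_if_generate:
  assumes "S \<subseteq> carrier G" "generate G S = carrier G"
  shows "normally_generates G S"
proof -
  have "carrier G \<subseteq> N" if "N \<lhd> G" "S \<subseteq> N" for N
    using generate_subgroup_incl[OF that(2) normal_imp_subgroup[OF that(1)]] assms(2) by simp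
  moreover have "carrier G \<lhd> G"
    by (rule normal_invI) (auto simp: subgroup_self)
  ultimately show ?thesis
    using assms(1) unfolding normally_generates_def normal_closure_def by blast
qed

lemma conj_set_closed: "conj_set G S \<subseteq> carrier G"
  by (auto simp: conj_set_def)

lemma conj_mem_conj_set:
  "\<lbrakk>s \<in> S; s \<in> carrier G; h \<in> carrier G\<rbrakk> \<Longrightarrow> inv h \<otimes> s \<otimes> h \<in> conj_set G S"
  by (auto simp: conj_set_def)

lemma inv_mem_conj_set:
  assumes "x \<in> conj_set G S" shows "inv x \<in> conj_set G S"
proof -
  obtain h s where x: "x = inv h \<otimes> s \<otimes> h" and h: "h \<in> carrier G"
    and s: "s \<in> carrier G" "s \<in> S \<or> inv s \<in> S"
    using assms by (auto simp: conj_set_def)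
  have "inv x = inv h \<otimes> inv s \<otimes> h"
    using h s by (simp add: x inv_mult_group m_assoc)
  then show ?thesis
    unfolding conj_set_def using h s by (force simp: inv_inv)
qed

lemma conj_norm_le:
  assumes "set xs \<subseteq> conj_set G S" "foldr (\<otimes>) xs \<one> = g" "length xs \<le> k"
  shows "conj_norm G S g \<le> enat k"
proof -
  have "conj_norm G S g \<le> enat (length xs)"
    unfolding conj_norm_def using assms by (intro INF_lower) auto
  with assms(3) show ?thesis by (simp add: order_trans)
qed

end


section \<open>Groups satisfying the relations of the modular group\<close>

text \<open>The maps \<open>\<alpha>\<close> and \<open>\<beta>\<close> are integer lifts of the two coordinates of the abelianisation.\<close>

locale modular_relations = group G for G (structure) +
  fixes a b :: 'a and p m r :: nat and \<alpha> \<beta> :: "'a \<Rightarrow> int"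
  assumes p: "prime p" and m: "m = p ^ r" "0 < r"
    and a_closed [simp]: "a \<in> carrier G" and b_closed [simp]: "b \<in> carrier G"
    and a_pow: "a [^] (p * m) = \<one>" and b_pow: "b [^] p = \<one>"
    and a_conj_b: "inv b \<otimes> a \<otimes> b = a [^] (1 + m)"
    and generated: "generate G {a, b} = carrier G"
    and \<alpha>: "additive_mod (int m) \<alpha>" and \<alpha>_a: "[\<alpha> a = 1] (mod int m)" and \<alpha>_b: "[\<alpha> b = 0] (mod int m)"
    and \<beta>: "additive_mod (int p) \<beta>" and \<beta>_a: "[\<beta> a = 0] (mod int p)" and \<beta>_b: "[\<beta> b = 1] (mod int p)"
begin

lemma p_dvd_m: "int p dvd int m"
  using m by simp

lemma m_pos: "0 < m"
  using p m by (simp add: prime_gt_0_nat)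

lemma prime_int_p: "prime (int p)"
  using p by simp

section \<open>The central element and commutators\<close>

definition c :: 'a where "c = a [^] m"

lemma c_closed [simp]: "c \<in> carrier G"
  by (simp add: c_def)

lemma a_int_pow_mult: "a [^] (int m * q) = c [^] (q::int)"
  by (simp add: c_def int_pow_pow flip: int_pow_int)

lemma c_pow_p: "c [^] (int p * q) = \<one>"
proof -
  have "c [^] (int p * q) = (c [^] int p) [^] q"
    by (simp add: int_pow_pow)
  also have "c [^] int p = a [^] (p * m)"
    by (simp add: c_def int_pow_int nat_pow_pow mult.commute)
  finally show ?thesis by (simp add: a_pow)
qed

text \<open>The \<open>p\<close>-th power of \<open>c\<close> is \<open>a [^] (p * m)\<close>, which
  is trivial. Equations between exponents of \<open>c\<close> can thus be solved modulo the prime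
  \<open>p\<close>.\<close>

lemma c_pow_cong:
  assumes "[i = j] (mod int p)"
  shows "c [^] i = c [^] j"
proof -
  obtain q where "j = i + int p * q" using assms by (auto simp: cong_iff_lin)
  then show ?thesis by (simp add: int_pow_mult c_pow_p)
qed

lemma b_pow_p: "b [^] (int p * q) = \<one>"
  using b_pow by (simp add: int_pow_int flip: int_pow_pow)

lemma a_conj_b': "inv b \<otimes> a \<otimes> b = a \<otimes> c"
  by (simp add: a_conj_b c_def group_commutes_pow)

lemma c_comm_a: "c \<otimes> a = a \<otimes> c"
  unfolding c_def by (rule group_commutes_pow[OF HOL.refl]) auto

text \<open>Conjugation by \<open>b\<close> sends \<open>a\<close> to \<open>a \<otimes> c\<close>,
  hence \<open>c\<close> to the product of the \<open>m\<close>-th powers of \<open>a\<close> and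
  \<open>c\<close>; the latter is trivial since \<open>p\<close> divides \<open>m\<close>.\<close>

lemma c_comm_b: "c \<otimes> b = b \<otimes> c"
proof -
  have "inv b \<otimes> c \<otimes> b = inv b \<otimes> a [^] int m \<otimes> b"
    by (simp add: c_def int_pow_int)
  also have "\<dots> = (a \<otimes> c) [^] int m"
    by (simp add: conj_int_pow a_conj_b')
  also have "\<dots> = a [^] int m \<otimes> c [^] int m"
    using c_comm_a by (intro int_pow_mult_distrib) auto
  also have "c [^] int m = \<one>"
    using p_dvd_m c_pow_p by (auto elim: dvdE)
  finally have "inv b \<otimes> c \<otimes> b = c" by (simp add: c_def int_pow_int)
  then show ?thesis by (simp add: conj_eq_iff)
qed

lemma c_central:
  assumes "x \<in> carrier G"
  shows "c [^] (k::int) \<otimes> x = x \<otimes> c [^] k"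
proof -
  have "x \<otimes> c = c \<otimes> x" if "x \<in> generate G {a, b}"
    using that
  proof induction
    case (inv h)
    then have h: "h \<in> carrier G" "h \<otimes> c = c \<otimes> h" using c_comm_a c_comm_b by auto
    from commute_int_pow[OF h(1) _ h(2), of "-1"] show ?case
      using h by (simp add: int_pow_neg)
  next
    case (eng h1 h2)
    have car: "h1 \<in> carrier G" "h2 \<in> carrier G" using eng generated by auto
    have "h1 \<otimes> h2 \<otimes> c = (h1 \<otimes> c) \<otimes> h2" using car eng.IH(2) by (simp add: m_assoc)
    then show ?case using car eng.IH(1) by (simp add: m_assoc)
  qed (use c_comm_a c_comm_b in auto)
  then show ?thesis using assms generated by (intro commute_int_pow) auto
qed

text \<open>The commutator is bilinear in the exponents because \<open>c\<close> commutes with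
  \<open>a\<close> and \<open>b\<close>. One exponent is treated at a time: the action of
  \<open>b\<close> on \<open>a\<close> is raised to the power \<open>i\<close>, reread as the action
  of \<open>a [^] i\<close> on \<open>b\<close>, and then raised to the power
  \<open>t\<close>.\<close>

lemma a_conj_b_pow:
  shows "inv (b [^] t) \<otimes> a [^] (i::int) \<otimes> b [^] (t::int) = a [^] i \<otimes> c [^] (i * t)"
    and "inv (a [^] i) \<otimes> b [^] t \<otimes> a [^] i = b [^] t \<otimes> c [^] (- (i * t))"
proof -
  let ?A = "a [^] i" and ?B = "b [^] t"
  have "inv b \<otimes> ?A \<otimes> b = ?A \<otimes> c [^] i"
    using c_comm_a by (simp add: conj_int_pow a_conj_b' int_pow_mult_distrib)
  then have "?A \<otimes> b = b \<otimes> (?A \<otimes> c [^] i)"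
    by (simp add: conj_eq_iff)
  then have "?A \<otimes> b \<otimes> c [^] (-i) = b \<otimes> ?A"
    by (simp add: m_assoc flip: int_pow_mult)
  then have "b \<otimes> ?A = ?A \<otimes> (b \<otimes> c [^] (-i))"
    by (simp add: m_assoc)
  then have "inv ?A \<otimes> b \<otimes> ?A = b \<otimes> c [^] (-i)"
    by (simp add: conj_eq_iff)
  then have "inv ?A \<otimes> ?B \<otimes> ?A = (b \<otimes> c [^] (-i)) [^] t"
    by (simp add: conj_int_pow)
  also have "\<dots> = ?B \<otimes> c [^] (- (i * t))"
    by (simp add: c_central[OF b_closed] int_pow_mult_distrib int_pow_pow)
  finally show *: "inv ?A \<otimes> ?B \<otimes> ?A = ?B \<otimes> c [^] (- (i * t))" .
  then have "?B \<otimes> ?A = ?A \<otimes> (?B \<otimes> c [^] (- (i * t)))"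
    by (simp add: conj_eq_iff)
  then have "?B \<otimes> ?A \<otimes> c [^] (i * t) = ?A \<otimes> ?B"
    by (simp add: m_assoc flip: int_pow_mult)
  then have "?A \<otimes> ?B = ?B \<otimes> (?A \<otimes> c [^] (i * t))"
    by (simp add: m_assoc)
  then show "inv ?B \<otimes> ?A \<otimes> ?B = ?A \<otimes> c [^] (i * t)"
    by (simp add: conj_eq_iff)
qed

section \<open>Normal form and coordinates\<close>

lemma b_pow_mult_a_pow:
  "b [^] (t::int) \<otimes> a [^] (i::int) = a [^] i \<otimes> b [^] t \<otimes> c [^] (- (i * t))"
  using a_conj_b_pow(2)[of i t] by (simp add: conj_eq_iff flip: m_assoc)

lemma normal_form:
  assumes "g \<in> carrier G"
  shows "\<exists>(i::int) (j::int) (k::int). g = a [^] i \<otimes> b [^] j \<otimes> c [^] k"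
proof -
  have "g \<in> generate G {a, b}" using assms generated by simp
  then show ?thesis
  proof induction
    case one
    show ?case by (intro exI[of _ 0]) simp
  next
    case (incl h)
    then consider "h = a" | "h = b" by auto
    then show ?case
    proof cases
      case 1 then show ?thesis by (intro exI[of _ 1] exI[of _ 0]) simp
    next
      case 2 then show ?thesis by (intro exI[of _ 0] exI[of _ 1]) simp
    qed
  next
    case (inv h)
    then consider "h = a" | "h = b" by auto
    then show ?case
    proof cases
      case 1 then show ?thesis
        by (intro exI[of _ "-1"] exI[of _ 0]) (simp add: int_pow_neg)
    next
      case 2 then show ?thesis
        by (intro exI[of _ 0] exI[of _ "-1"]) (simp add: int_pow_neg)
    qed
  next
    case (eng h1 h2)
    then obtain i j k i' j' k' :: int
      where h1: "h1 = a [^] i \<otimes> b [^] j \<otimes> c [^] k" and h2: "h2 = a [^] i' \<otimes> b [^] j' \<otimes> c [^] k'"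
      by blast
    \<comment> \<open>Collection: \<open>c [^] k\<close> passes the second factor by centrality, and
      \<open>b [^] j\<close> passes \<open>a [^] i'\<close> at the cost of
      \<open>c [^] (- (i' * j))\<close>.\<close>
    have "h1 \<otimes> h2 = a [^] i \<otimes> b [^] j \<otimes> (c [^] k \<otimes> (a [^] i' \<otimes> b [^] j')) \<otimes> c [^] k'"
      by (simp add: h1 h2 m_assoc)
    also have "c [^] k \<otimes> (a [^] i' \<otimes> b [^] j') = a [^] i' \<otimes> b [^] j' \<otimes> c [^] k"
      by (rule c_central) simp
    also have "a [^] i \<otimes> b [^] j \<otimes> (a [^] i' \<otimes> b [^] j' \<otimes> c [^] k) \<otimes> c [^] k'
        = a [^] i \<otimes> (b [^] j \<otimes> a [^] i') \<otimes> b [^] j' \<otimes> c [^] k \<otimes> c [^] k'"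
      by (simp add: m_assoc)
    also have "\<dots> = a [^] i \<otimes> a [^] i' \<otimes> b [^] j \<otimes> (c [^] (- (i' * j)) \<otimes> b [^] j') \<otimes> c [^] k \<otimes> c [^] k'"
      unfolding b_pow_mult_a_pow by (simp add: m_assoc)
    also have "c [^] (- (i' * j)) \<otimes> b [^] j' = b [^] j' \<otimes> c [^] (- (i' * j))"
      by (rule c_central) simp
    also have "a [^] i \<otimes> a [^] i' \<otimes> b [^] j \<otimes> (b [^] j' \<otimes> c [^] (- (i' * j))) \<otimes> c [^] k \<otimes> c [^] k'
        = (a [^] i \<otimes> a [^] i') \<otimes> (b [^] j \<otimes> b [^] j') \<otimes> (c [^] (- (i' * j)) \<otimes> c [^] k \<otimes> c [^] k')"
      by (simp add: m_assoc)
    also have "\<dots> = a [^] (i + i') \<otimes> b [^] (j + j') \<otimes> c [^] (- (i' * j) + k + k')"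
      by (simp only: int_pow_mult a_closed b_closed c_closed)
    finally show ?case by blast
  qed
qed

text \<open>As \<open>c\<close> is an \<open>m\<close>-th power, \<open>f\<close> kills it modulo
  any divisor \<open>d\<close> of \<open>m\<close>. A general \<open>d\<close> serves both \<alpha>
  (modulo \<open>m\<close>) and \<beta> (modulo \<open>p\<close>).\<close>

lemma additive_normal_form:
  fixes i j k :: int
  assumes f: "additive_mod d f" and d: "d dvd int m"
  shows "[f (a [^] i \<otimes> b [^] j \<otimes> c [^] k) = i * f a + j * f b] (mod d)"
proof -
  have "[f (c [^] k) = int m * k * f a] (mod d)"
    using additive_mod_int_pow[OF f, of a "int m * k"] by (simp add: a_int_pow_mult)
  also have "[int m * k * f a = 0] (mod d)"
    using d by (simp add: cong_0_iff)
  finally have "[f (a [^] i) + f (b [^] j) + f (c [^] k) = i * f a + j * f b + 0] (mod d)"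
    by (intro cong_add additive_mod_int_pow[OF f]) auto
  moreover have "[f (a [^] i \<otimes> b [^] j \<otimes> c [^] k) = f (a [^] i \<otimes> b [^] j) + f (c [^] k)] (mod d)"
    by (intro additive_mod_mult[OF f]) auto
  moreover have "[f (a [^] i \<otimes> b [^] j) + f (c [^] k) = f (a [^] i) + f (b [^] j) + f (c [^] k)] (mod d)"
    by (intro cong_add additive_mod_mult[OF f]) auto
  ultimately show ?thesis
    by (auto intro: cong_trans)
qed

lemma \<alpha>_normal_form: "[\<alpha> (a [^] (i::int) \<otimes> b [^] (j::int) \<otimes> c [^] (k::int)) = i] (mod int m)"
proof -
  have "[i * \<alpha> a + j * \<alpha> b = i * 1 + j * 0] (mod int m)"
    by (intro cong_add cong_mult \<alpha>_a \<alpha>_b) auto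
  with additive_normal_form[OF \<alpha>, of i j k] show ?thesis by (auto intro: cong_trans)
qed

lemma \<beta>_normal_form: "[\<beta> (a [^] (i::int) \<otimes> b [^] (j::int) \<otimes> c [^] (k::int)) = j] (mod int p)"
proof -
  have "[i * \<beta> a + j * \<beta> b = i * 0 + j * 1] (mod int p)"
    by (intro cong_add cong_mult \<beta>_a \<beta>_b) auto
  with additive_normal_form[OF \<beta> p_dvd_m, of i j k] show ?thesis by (auto intro: cong_trans)
qed

text \<open>The common kernel of \<alpha> and \<beta> consists of powers of \<open>c\<close>: in the
  normal form of \<open>inv h \<otimes> g\<close> the exponent of \<open>a\<close> is a multiple of
  \<open>m\<close> and that of \<open>b\<close> a multiple of \<open>p\<close>.\<close>

lemma eq_mult_c_pow:
  assumes "g \<in> carrier G" "h \<in> carrier G" "[\<alpha> g = \<alpha> h] (mod int m)" "[\<beta> g = \<beta> h] (mod int p)"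
  shows "\<exists>k::int. g = h \<otimes> c [^] k"
proof -
  obtain i j k :: int where ijk: "inv h \<otimes> g = a [^] i \<otimes> b [^] j \<otimes> c [^] k"
    using normal_form assms by (metis inv_closed m_closed)
  have quot: "[f (inv h \<otimes> g) = 0] (mod d)" if "additive_mod d f" "[f g = f h] (mod d)" for f d
  proof -
    have "[f (inv h \<otimes> g) = f (inv h) + f g] (mod d)"
      using assms that by (intro additive_mod_mult) auto
    also have "[f (inv h) + f g = - f h + f h] (mod d)"
      using assms that by (intro cong_add additive_mod_inv) auto
    finally show ?thesis by simp
  qed
  have "int m dvd i"
    using quot[OF \<alpha> assms(3)] \<alpha>_normal_form[of i j k] unfolding ijk
    by (simp add: cong_0_iff cong_dvd_iff)
  then obtain q where q: "i = int m * q" by (elim dvdE)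
  have "int p dvd j"
    using quot[OF \<beta> assms(4)] \<beta>_normal_form[of i j k] unfolding ijk
    by (simp add: cong_0_iff cong_dvd_iff)
  then have "inv h \<otimes> g = c [^] (q + k)"
    using ijk by (auto simp: q a_int_pow_mult b_pow_p int_pow_mult elim: dvdE)
  then show ?thesis
    using assms by (metis inv_solve_left c_closed int_pow_closed)
qed

section \<open>Conjugacy classes and factorisations of powers\<close>

text \<open>One of the exponents \<open>i\<close>, \<open>j\<close> in the normal form of
  \<open>z\<close> is invertible modulo \<open>p\<close>. Conjugation by \<open>b [^] t\<close>
  multiplies \<open>z\<close> by \<open>c [^] (i * t)\<close>, conjugation by \<open>a [^] t\<close>
  by \<open>c [^] (- (t * j))\<close>, and a linear congruence determines \<open>t\<close>.\<close>

lemma conj_eq_mult_c_pow: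
  assumes z: "z \<in> carrier G" and nc: "\<not> [\<alpha> z = 0] (mod int p) \<or> \<not> [\<beta> z = 0] (mod int p)"
  shows "\<exists>h\<in>carrier G. inv h \<otimes> z \<otimes> h = z \<otimes> c [^] (k::int)"
proof -
  obtain i j l :: int where z_eq: "z = a [^] i \<otimes> b [^] j \<otimes> c [^] l"
    using normal_form z by blast
  have \<alpha>z: "[\<alpha> z = i] (mod int p)"
    unfolding z_eq using \<alpha>_normal_form p_dvd_m by (rule cong_dvd_modulus)
  have \<beta>z: "[\<beta> z = j] (mod int p)"
    unfolding z_eq by (rule \<beta>_normal_form)
  consider "\<not> [i = 0] (mod int p)" | "\<not> [j = 0] (mod int p)"
    using nc \<alpha>z \<beta>z by (auto simp: cong_def)
  then show ?thesis
  proof cases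
    case 1
    then obtain t where t: "[i * t = k] (mod int p)" using cong_mult_solvable[OF _ prime_int_p] by blast
    let ?h = "b [^] t"
    have "inv ?h \<otimes> (a [^] i \<otimes> (b [^] j \<otimes> c [^] l)) \<otimes> ?h
        = (inv ?h \<otimes> a [^] i \<otimes> ?h) \<otimes> (inv ?h \<otimes> (b [^] j \<otimes> c [^] l) \<otimes> ?h)"
      by (rule conj_mult) auto
    also have "inv ?h \<otimes> (b [^] j \<otimes> c [^] l) \<otimes> ?h = b [^] j \<otimes> c [^] l"
    proof -
      have "b [^] j \<otimes> c [^] l \<otimes> ?h = b [^] j \<otimes> ?h \<otimes> c [^] l"
        using c_central[of ?h l] by (simp add: m_assoc)
      also have "b [^] j \<otimes> ?h = ?h \<otimes> b [^] j"
        by (simp add: add.commute flip: int_pow_mult)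
      finally have "b [^] j \<otimes> c [^] l \<otimes> ?h = ?h \<otimes> (b [^] j \<otimes> c [^] l)"
        by (simp add: m_assoc)
      then show ?thesis by (simp add: conj_eq_iff)
    qed
    also have "inv ?h \<otimes> a [^] i \<otimes> ?h = a [^] i \<otimes> c [^] k"
      using a_conj_b_pow(1) c_pow_cong[OF t] by simp
    also have "a [^] i \<otimes> c [^] k \<otimes> (b [^] j \<otimes> c [^] l) = a [^] i \<otimes> (c [^] k \<otimes> (b [^] j \<otimes> c [^] l))"
      by (simp add: m_assoc)
    also have "c [^] k \<otimes> (b [^] j \<otimes> c [^] l) = b [^] j \<otimes> c [^] l \<otimes> c [^] k"
      by (rule c_central) simp
    finally have "inv ?h \<otimes> z \<otimes> ?h = z \<otimes> c [^] k"
      by (simp add: z_eq m_assoc)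
    then show ?thesis by (rule bexI[of _ ?h]) simp
  next
    case 2
    \<comment> \<open>The sign compensates for the exponent \<open>- (t * j)\<close> that
      conjugation by \<open>a [^] t\<close> produces.\<close>
    then obtain t where t: "[j * t = - k] (mod int p)" using cong_mult_solvable[OF _ prime_int_p] by blast
    then have t': "[- (t * j) = k] (mod int p)"
      by (metis cong_minus_minus_iff minus_minus mult.commute)
    let ?h = "a [^] t"
    have "inv ?h \<otimes> (a [^] i \<otimes> b [^] j \<otimes> c [^] l) \<otimes> ?h
        = (inv ?h \<otimes> (a [^] i \<otimes> b [^] j) \<otimes> ?h) \<otimes> (inv ?h \<otimes> c [^] l \<otimes> ?h)"
      by (rule conj_mult) auto
    also have "inv ?h \<otimes> (a [^] i \<otimes> b [^] j) \<otimes> ?h = (inv ?h \<otimes> a [^] i \<otimes> ?h) \<otimes> (inv ?h \<otimes> b [^] j \<otimes> ?h)"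
      by (rule conj_mult) auto
    also have "inv ?h \<otimes> c [^] l \<otimes> ?h = c [^] l"
      using c_central[of ?h] by (simp add: conj_eq_iff)
    also have "inv ?h \<otimes> a [^] i \<otimes> ?h = a [^] i"
      by (simp add: conj_eq_iff add.commute flip: int_pow_mult)
    also have "inv ?h \<otimes> b [^] j \<otimes> ?h = b [^] j \<otimes> c [^] k"
      using a_conj_b_pow(2) c_pow_cong[OF t'] by simp
    finally have "inv ?h \<otimes> z \<otimes> ?h = a [^] i \<otimes> b [^] j \<otimes> (c [^] k \<otimes> c [^] l)"
      by (simp add: z_eq m_assoc)
    also have "c [^] k \<otimes> c [^] l = c [^] l \<otimes> c [^] k"
      by (rule c_central) simp
    finally have "inv ?h \<otimes> z \<otimes> ?h = z \<otimes> c [^] k"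
      by (simp add: z_eq m_assoc)
    then show ?thesis by (rule bexI[of _ ?h]) simp
  qed
qed

text \<open>By centrality of \<open>c\<close>, the element \<open>inv z \<otimes> c [^] k\<close> is
  the inverse of the conjugate \<open>z \<otimes> c [^] (- k)\<close>.\<close>

lemma mult_c_pow_mem_conj_set:
  assumes "z \<in> S" "z \<in> carrier G" "\<not> [\<alpha> z = 0] (mod int p) \<or> \<not> [\<beta> z = 0] (mod int p)"
  shows "z \<otimes> c [^] (k::int) \<in> conj_set G S" "inv z \<otimes> c [^] k \<in> conj_set G S"
proof -
  have *: "z \<otimes> c [^] k \<in> conj_set G S" for k :: int
    using conj_eq_mult_c_pow[OF assms(2,3), of k] conj_mem_conj_set[OF assms(1,2)] by metis
  show "z \<otimes> c [^] k \<in> conj_set G S" by (rule *)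
  have "inv (z \<otimes> c [^] (- k)) = c [^] k \<otimes> inv z"
    using assms(2) by (simp add: inv_mult_group int_pow_neg)
  also have "\<dots> = inv z \<otimes> c [^] k"
    using assms(2) by (simp add: c_central)
  finally show "inv z \<otimes> c [^] k \<in> conj_set G S"
    using inv_mem_conj_set[OF *] by metis
qed

text \<open>A single factor absorbs all of \<open>c [^] k\<close>, and the others are plain copies
  of \<open>z\<close> or \<open>inv z\<close>; \<open>i \<noteq> 0\<close> ensures that there is
  such a factor. The tail \<open>g\<close> lets factorisations be concatenated under
  \<open>foldr\<close>.\<close>

lemma pow_mult_c_pow_factorisation:
  assumes z: "z \<in> S" "z \<in> carrier G" "\<not> [\<alpha> z = 0] (mod int p) \<or> \<not> [\<beta> z = 0] (mod int p)"
    and "i \<noteq> 0"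
  shows "\<exists>xs. set xs \<subseteq> conj_set G S \<and> length xs = nat \<bar>i\<bar> \<and>
    (\<forall>g\<in>carrier G. foldr (\<otimes>) xs g = z [^] (i::int) \<otimes> c [^] (k::int) \<otimes> g)"
proof -
  define y where "y = (if i > 0 then z else inv z)"
  obtain e where e: "nat \<bar>i\<bar> = Suc e" using assms(4) by (cases "nat \<bar>i\<bar>") auto
  have y: "y \<in> carrier G" using z by (simp add: y_def)
  have y_pow: "y [^] Suc e = z [^] i"
  proof (cases "i > 0")
    case True
    then have "i = int (Suc e)" using e by linarith
    then show ?thesis using True by (simp add: y_def int_pow_int del: of_nat_Suc)
  next
    case False
    then have "i = - int (Suc e)" using e assms(4) by linarith
    then show ?thesis using False z(2)
      by (simp only: y_def if_False nat_pow_inv int_pow_neg int_pow_int)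
  qed
  have y_conj: "y \<otimes> c [^] k \<in> conj_set G S" for k :: int
    using mult_c_pow_mem_conj_set[OF z] by (simp add: y_def)
  have "foldr (\<otimes>) (y \<otimes> c [^] k # replicate e y) g = z [^] i \<otimes> c [^] k \<otimes> g" if g: "g \<in> carrier G" for g
  proof -
    have "foldr (\<otimes>) (y \<otimes> c [^] k # replicate e y) g = y \<otimes> (c [^] k \<otimes> y [^] e) \<otimes> g"
      using foldr_replicate_mult[OF y g] y g by (simp add: m_assoc del: foldr_replicate)
    also have "c [^] k \<otimes> y [^] e = y [^] e \<otimes> c [^] k"
      using y by (intro c_central) simp
    also have "y \<otimes> (y [^] e \<otimes> c [^] k) \<otimes> g = y [^] Suc e \<otimes> c [^] k \<otimes> g"
      using y g unfolding nat_pow_Suc2[OF y] by (simp add: m_assoc)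
    finally show ?thesis by (simp only: y_pow)
  qed
  moreover have "set (y \<otimes> c [^] k # replicate e y) \<subseteq> conj_set G S"
    using y_conj[of k] y_conj[of 0] y by auto
  ultimately show ?thesis
    using e by (intro exI[of _ "y \<otimes> c [^] k # replicate e y"]) auto
qed

lemma pow_factorisation:
  assumes z: "z \<in> S" "z \<in> carrier G" "\<not> [\<alpha> z = 0] (mod int p) \<or> \<not> [\<beta> z = 0] (mod int p)"
  shows "\<exists>xs. set xs \<subseteq> conj_set G S \<and> length xs = nat \<bar>i\<bar> \<and>
    (\<forall>g\<in>carrier G. foldr (\<otimes>) xs g = z [^] (i::int) \<otimes> g)"
proof (cases "i = 0")
  case False
  then show ?thesis using pow_mult_c_pow_factorisation[OF z, of i 0] z(2) by simp
qed (auto intro: exI[of _ "[]"])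

section \<open>Upper bound for the conjugacy norm\<close>

text \<open>Both halves are at least 1, as \<open>p\<close> divides \<open>m\<close>. This leaves
  room for the powers of \<open>c\<close>, which are written with two factors.\<close>

lemma half_sum_ge_2: "2 \<le> m div 2 + p div 2"
proof -
  have "p \<le> m" using p_dvd_m m_pos by (simp add: dvd_imp_le)
  then have "1 \<le> m div 2" "1 \<le> p div 2" using prime_ge_2_nat[OF p] by linarith+
  then show ?thesis by linarith
qed

text \<open>The first power with nonzero exponent absorbs \<open>c [^] k\<close>. If both exponents
  vanish, \<open>c [^] k\<close> is the product of \<open>x\<close> and
  \<open>inv x \<otimes> c [^] k\<close>, whence the 2 in the maximum.\<close>

lemma conj_norm_pow_mult_pow_le:
  fixes i j k :: int
  assumes x: "x \<in> S" "x \<in> carrier G" "\<not> [\<alpha> x = 0] (mod int p) \<or> \<not> [\<beta> x = 0] (mod int p)"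
    and y: "y \<in> S" "y \<in> carrier G" "\<not> [\<alpha> y = 0] (mod int p) \<or> \<not> [\<beta> y = 0] (mod int p)"
  shows "conj_norm G S (x [^] i \<otimes> y [^] j \<otimes> c [^] k) \<le> enat (max 2 (nat \<bar>i\<bar> + nat \<bar>j\<bar>))"
proof -
  consider "i \<noteq> 0" | "i = 0" "j \<noteq> 0" | "i = 0" "j = 0" by blast
  then show ?thesis
  proof cases
    case 1
    then obtain xs where xs: "set xs \<subseteq> conj_set G S" "length xs = nat \<bar>i\<bar>"
      "\<And>g. g \<in> carrier G \<Longrightarrow> foldr (\<otimes>) xs g = x [^] i \<otimes> c [^] k \<otimes> g"
      using pow_mult_c_pow_factorisation[OF x] by blast
    obtain ys where ys: "set ys \<subseteq> conj_set G S" "length ys = nat \<bar>j\<bar>"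
      "\<And>g. g \<in> carrier G \<Longrightarrow> foldr (\<otimes>) ys g = y [^] j \<otimes> g"
      using pow_factorisation[OF y] by blast
    have "foldr (\<otimes>) (xs @ ys) \<one> = x [^] i \<otimes> (c [^] k \<otimes> y [^] j)"
      using xs(3) ys(3) x(2) y(2) by (simp add: m_assoc)
    also have "c [^] k \<otimes> y [^] j = y [^] j \<otimes> c [^] k"
      using y(2) by (intro c_central) simp
    finally show ?thesis
      using xs ys x(2) y(2) by (intro conj_norm_le[of "xs @ ys"]) (auto simp: m_assoc)
  next
    case 2
    then obtain ys where ys: "set ys \<subseteq> conj_set G S" "length ys = nat \<bar>j\<bar>"
      "\<And>g. g \<in> carrier G \<Longrightarrow> foldr (\<otimes>) ys g = y [^] j \<otimes> c [^] k \<otimes> g"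
      using pow_mult_c_pow_factorisation[OF y] by blast
    then show ?thesis
      using 2 y(2) by (intro conj_norm_le[of ys]) auto
  next
    case 3
    have "x \<otimes> (inv x \<otimes> c [^] k) = c [^] k"
      using x(2) by (simp flip: m_assoc)
    then show ?thesis
      using 3 mult_c_pow_mem_conj_set[OF x, of 0] mult_c_pow_mem_conj_set[OF x, of k] x(2)
      by (intro conj_norm_le[of "[x, inv x \<otimes> c [^] k]"]) auto
  qed
qed

text \<open>Modulo \<open>p\<close>, \<alpha> does not vanish at \<open>a\<close>, which yields
  \<open>x\<close>. With \<open>x\<close> fixed, the determinant of the coordinates is a
  homomorphism with value \<open>\<alpha> x\<close> at \<open>b\<close>, hence nonzero, which yields
  \<open>y\<close>. The coordinates of \<open>x\<close> and \<open>y\<close> are thus independent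
  modulo \<open>p\<close>.\<close>

lemma exists_exponents:
  assumes S: "normally_generates G S"
  shows "\<exists>x\<in>S. \<exists>y\<in>S. \<not> [\<alpha> x = 0] (mod int p) \<and>
    \<not> [\<alpha> x * \<beta> y - \<beta> x * \<alpha> y = 0] (mod int p)"
proof -
  have not_one: "\<not> [1 = 0] (mod int p)"
    using prime_gt_1_nat[OF p] by (simp add: cong_0_iff)
  have \<alpha>': "additive_mod (int p) \<alpha>"
    using \<alpha> p_dvd_m unfolding additive_mod_def by (blast intro: cong_dvd_modulus)
  have "[\<alpha> a = 1] (mod int p)" using \<alpha>_a p_dvd_m by (rule cong_dvd_modulus)
  then have "\<not> [\<alpha> a = 0] (mod int p)"
    using not_one cong_sym cong_trans by blast
  then obtain x where x: "x \<in> S" "\<not> [\<alpha> x = 0] (mod int p)"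
    using normally_generates_not_additive_kernel[OF S \<alpha>' a_closed] by blast
  define f where "f g = \<alpha> x * \<beta> g - \<beta> x * \<alpha> g" for g
  have "additive_mod (int p) f"
    unfolding additive_mod_def
  proof (intro ballI)
    fix g h assume g: "g \<in> carrier G" and h: "h \<in> carrier G"
    have "[f (g \<otimes> h) = \<alpha> x * (\<beta> g + \<beta> h) - \<beta> x * (\<alpha> g + \<alpha> h)] (mod int p)"
      unfolding f_def
      by (intro cong_diff cong_scalar_left additive_mod_mult[OF \<alpha>'] additive_mod_mult[OF \<beta>] g h)
    then show "[f (g \<otimes> h) = f g + f h] (mod int p)"
      by (simp add: f_def algebra_simps)
  qed
  moreover have "\<not> [f b = 0] (mod int p)"
  proof -
    have "[\<alpha> b = 0] (mod int p)" using \<alpha>_b p_dvd_m by (rule cong_dvd_modulus)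
    then have "[f b = \<alpha> x * 1 - \<beta> x * 0] (mod int p)"
      unfolding f_def by (intro cong_diff cong_scalar_left \<beta>_b)
    then show ?thesis using x(2) by (auto simp: cong_def)
  qed
  ultimately obtain y where "y \<in> S" "\<not> [f y = 0] (mod int p)"
    using normally_generates_not_additive_kernel[OF S _ b_closed] by blast
  then show ?thesis using x unfolding f_def by blast
qed

text \<open>Modulo \<open>c\<close>, the powers of \<open>x\<close> already exhaust an index-\<open>p\<close> subgroup, so
  \<open>j\<close> is determined modulo \<open>p\<close> by a determinant and then \<open>i\<close> modulo \<open>m\<close>.\<close>

lemma exists_small_exponents:
  assumes x: "x \<in> carrier G" "\<not> [\<alpha> x = 0] (mod int p)"
    and y: "y \<in> carrier G" "\<not> [\<alpha> x * \<beta> y - \<beta> x * \<alpha> y = 0] (mod int p)"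
    and g: "g \<in> carrier G"
  shows "\<exists>i j k :: int. \<bar>i\<bar> \<le> int (m div 2) \<and> \<bar>j\<bar> \<le> int (p div 2) \<and>
    g = x [^] i \<otimes> y [^] j \<otimes> c [^] k"
proof -
  define d where "d = \<alpha> x * \<beta> y - \<beta> x * \<alpha> y"
  \<comment> \<open>Cramer's rule for the exponent of \<open>y\<close>, in coordinates modulo
    \<open>p\<close>.\<close>
  obtain j0 where j0: "[d * j0 = \<alpha> x * \<beta> g - \<beta> x * \<alpha> g] (mod int p)"
    using cong_mult_solvable[OF _ prime_int_p] y(2) unfolding d_def by blast
  obtain j where j: "[j = j0] (mod int p)" "\<bar>j\<bar> \<le> int (p div 2)"
    using exists_small_residue prime_gt_0_nat[OF p] by blast
  have dj: "[d * j = \<alpha> x * \<beta> g - \<beta> x * \<alpha> g] (mod int p)"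
    using j0 cong_scalar_left[OF j(1), of d] cong_trans by blast
  have cop_p: "coprime (\<alpha> x) (int p)"
    using x(2) prime_int_p by (metis cong_0_iff coprime_commute prime_imp_coprime)
  then have "coprime (\<alpha> x) (int m)"
    by (simp add: m)
  then obtain t where t: "[\<alpha> x * t = 1] (mod int m)" using cong_solve_coprime_int by blast
  \<comment> \<open>Once the small \<open>j\<close> is fixed, the equation for \<alpha> is solved
    for \<open>i\<close>, as \<open>\<alpha> x\<close> is a unit modulo \<open>m\<close>.\<close>
  obtain i where i: "[i = t * (\<alpha> g - j * \<alpha> y)] (mod int m)" "\<bar>i\<bar> \<le> int (m div 2)"
    using exists_small_residue m_pos by blast
  have "[i * \<alpha> x = t * (\<alpha> g - j * \<alpha> y) * \<alpha> x] (mod int m)"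
    by (rule cong_scalar_right[OF i(1)])
  also have "t * (\<alpha> g - j * \<alpha> y) * \<alpha> x = (\<alpha> x * t) * (\<alpha> g - j * \<alpha> y)"
    by (simp add: mult_ac)
  also have "[(\<alpha> x * t) * (\<alpha> g - j * \<alpha> y) = 1 * (\<alpha> g - j * \<alpha> y)] (mod int m)"
    by (rule cong_scalar_right[OF t])
  finally have i\<alpha>: "[i * \<alpha> x = \<alpha> g - j * \<alpha> y] (mod int m)" by simp
  have "[i * \<alpha> x + j * \<alpha> y = (\<alpha> g - j * \<alpha> y) + j * \<alpha> y] (mod int m)"
    by (intro cong_add i\<alpha>) auto
  then have \<alpha>_sum: "[i * \<alpha> x + j * \<alpha> y = \<alpha> g] (mod int m)" by simp
  \<comment> \<open>Modulo \<open>p\<close>, \<open>\<beta> x\<close> times the equation for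
    \<alpha> plus Cramer's equation is \<open>\<alpha> x\<close> times the equation for \<beta>, and
    \<open>\<alpha> x\<close> cancels.\<close>
  have "[\<beta> x * (i * \<alpha> x) + d * j + \<beta> x * (\<alpha> y * j)
      = \<beta> x * (\<alpha> g - j * \<alpha> y) + (\<alpha> x * \<beta> g - \<beta> x * \<alpha> g) + \<beta> x * (\<alpha> y * j)] (mod int p)"
    using cong_dvd_modulus[OF i\<alpha> p_dvd_m] by (intro cong_add cong_scalar_left dj) auto
  then have "[\<alpha> x * (i * \<beta> x + j * \<beta> y) = \<alpha> x * \<beta> g] (mod int p)"
    by (simp add: d_def algebra_simps)
  then have \<beta>_sum: "[i * \<beta> x + j * \<beta> y = \<beta> g] (mod int p)"
    using cong_mult_lcancel[OF cop_p] by blast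
  have eval: "[f (x [^] i \<otimes> y [^] j) = i * f x + j * f y] (mod q)" if "additive_mod q f" for f q
  proof -
    have "[f (x [^] i \<otimes> y [^] j) = f (x [^] i) + f (y [^] j)] (mod q)"
      using x y by (intro additive_mod_mult[OF that]) auto
    also have "[f (x [^] i) + f (y [^] j) = i * f x + j * f y] (mod q)"
      using x y by (intro cong_add additive_mod_int_pow[OF that])
    finally show ?thesis .
  qed
  have "\<exists>k::int. g = x [^] i \<otimes> y [^] j \<otimes> c [^] k"
  proof (rule eq_mult_c_pow)
    show "[\<alpha> g = \<alpha> (x [^] i \<otimes> y [^] j)] (mod int m)"
      using eval[OF \<alpha>] \<alpha>_sum by (metis cong_sym cong_trans)
    show "[\<beta> g = \<beta> (x [^] i \<otimes> y [^] j)] (mod int p)"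
      using eval[OF \<beta>] \<beta>_sum by (metis cong_sym cong_trans)
  qed (use x y g in auto)
  with i(2) j(2) show ?thesis by blast
qed

lemma group_conj_norm_le:
  assumes S: "normally_generates G S"
  shows "group_conj_norm G S \<le> enat (m div 2 + p div 2)"
  unfolding group_conj_norm_def
proof (rule SUP_least)
  fix g assume g: "g \<in> carrier G"
  obtain x y where xy: "x \<in> S" "y \<in> S" "\<not> [\<alpha> x = 0] (mod int p)"
    "\<not> [\<alpha> x * \<beta> y - \<beta> x * \<alpha> y = 0] (mod int p)"
    using exists_exponents[OF S] by blast
  have car: "x \<in> carrier G" "y \<in> carrier G"
    using S xy by (auto simp: normally_generates_def)
  \<comment> \<open>A nonzero determinant prevents both coordinates of \<open>y\<close> from
    vanishing modulo \<open>p\<close>.\<close>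
  have y_nc: "\<not> [\<alpha> y = 0] (mod int p) \<or> \<not> [\<beta> y = 0] (mod int p)"
    using xy(4) by (auto simp: cong_0_iff)
  obtain i j k :: int where ijk: "\<bar>i\<bar> \<le> int (m div 2)" "\<bar>j\<bar> \<le> int (p div 2)"
    "g = x [^] i \<otimes> y [^] j \<otimes> c [^] k"
    using exists_small_exponents[OF car(1) xy(3) car(2) xy(4) g] by blast
  have "conj_norm G S g \<le> enat (max 2 (nat \<bar>i\<bar> + nat \<bar>j\<bar>))"
    unfolding ijk(3) using xy car y_nc by (intro conj_norm_pow_mult_pow_le) auto
  also have "\<dots> \<le> enat (m div 2 + p div 2)"
    using ijk(1,2) half_sum_ge_2 by (simp add: add_mono nat_le_iff)
  finally show "conj_norm G S g \<le> enat (m div 2 + p div 2)" .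
qed

section \<open>Lower bound from the two generators\<close>

text \<open>Coordinates are constant on conjugacy classes, and those of a generator or its inverse
  are a unit vector up to sign. Representatives \<open>i\<close>, \<open>j\<close> are chosen
  because \<alpha> and \<beta> are arbitrary lifts whose values need not be small.\<close>

lemma conj_set_generators_exponents:
  assumes "x \<in> conj_set G {a, b}"
  shows "\<exists>i j. [\<alpha> x = i] (mod int m) \<and> [\<beta> x = j] (mod int p) \<and> \<bar>i\<bar> + \<bar>j\<bar> \<le> 1"
proof -
  obtain h s where x: "x = inv h \<otimes> s \<otimes> h" and h: "h \<in> carrier G"
    and s: "s \<in> carrier G" "s \<in> {a, b} \<or> inv s \<in> {a, b}"
    using assms by (auto simp: conj_set_def)
  have conj: "[f x = f s] (mod d)" if "additive_mod d f" for f d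
    unfolding x using additive_mod_conj[OF that s(1) h] .
  have "s = a \<or> s = b \<or> s = inv a \<or> s = inv b"
    using s inv_inv by auto
  moreover have "[\<alpha> (inv a) = - 1] (mod int m)" "[\<alpha> (inv b) = 0] (mod int m)"
    "[\<beta> (inv a) = 0] (mod int p)" "[\<beta> (inv b) = - 1] (mod int p)"
    using additive_mod_inv[OF \<alpha> a_closed] additive_mod_inv[OF \<alpha> b_closed]
      additive_mod_inv[OF \<beta> a_closed] additive_mod_inv[OF \<beta> b_closed] \<alpha>_a \<alpha>_b \<beta>_a \<beta>_b
    by (metis cong_minus_minus_iff cong_trans minus_zero)+
  ultimately have "\<exists>i j. [\<alpha> s = i] (mod int m) \<and> [\<beta> s = j] (mod int p) \<and> \<bar>i\<bar> + \<bar>j\<bar> \<le> 1"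
    using \<alpha>_a \<alpha>_b \<beta>_a \<beta>_b
    by (elim disjE) (force intro: exI[of _ 0] exI[of _ 1] exI[of _ "-1"])+
  then show ?thesis using conj[OF \<alpha>] conj[OF \<beta>] cong_trans by blast
qed

text \<open>Each factor moves the pair of coordinates by at most one in the l1 norm.\<close>

lemma foldr_generators_exponents:
  assumes "set xs \<subseteq> conj_set G {a, b}"
  shows "\<exists>i j. [\<alpha> (foldr (\<otimes>) xs \<one>) = i] (mod int m) \<and> [\<beta> (foldr (\<otimes>) xs \<one>) = j] (mod int p) \<and>
    \<bar>i\<bar> + \<bar>j\<bar> \<le> int (length xs)"
  using assms
proof (induction xs)
  case Nil
  show ?case
    using additive_mod_one[OF \<alpha>] additive_mod_one[OF \<beta>] by (intro exI[of _ 0]) auto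
next
  case (Cons x xs)
  let ?g = "foldr (\<otimes>) xs \<one>"
  have x: "x \<in> carrier G" using Cons.prems conj_set_closed by auto
  have g: "?g \<in> carrier G"
    using Cons.prems conj_set_closed by (intro foldr_mult_closed) auto
  obtain i j where ij: "[\<alpha> ?g = i] (mod int m)" "[\<beta> ?g = j] (mod int p)" "\<bar>i\<bar> + \<bar>j\<bar> \<le> int (length xs)"
    using Cons by auto
  obtain i' j' where ij': "[\<alpha> x = i'] (mod int m)" "[\<beta> x = j'] (mod int p)" "\<bar>i'\<bar> + \<bar>j'\<bar> \<le> 1"
    using conj_set_generators_exponents[of x] Cons.prems by fastforce
  have "[\<alpha> (x \<otimes> ?g) = i' + i] (mod int m)"
    using additive_mod_mult[OF \<alpha> x g] cong_add[OF ij'(1) ij(1)] by (rule cong_trans)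
  moreover have "[\<beta> (x \<otimes> ?g) = j' + j] (mod int p)"
    using additive_mod_mult[OF \<beta> x g] cong_add[OF ij'(2) ij(2)] by (rule cong_trans)
  moreover have "\<bar>i' + i\<bar> + \<bar>j' + j\<bar> \<le> int (length (x # xs))"
    using ij(3) ij'(3) by simp
  ultimately show ?case by (intro exI[of _ "i' + i"] exI[of _ "j' + j"]) simp
qed

text \<open>The coordinates of this element lie in the residue classes farthest from 0, so the
  exponents read off from any factorisation have absolute values at least \<open>m div 2\<close> and
  \<open>p div 2\<close>.\<close>

lemma conj_norm_generators_ge:
  fixes k :: int
  shows "enat (m div 2 + p div 2) \<le> conj_norm G {a, b} (a [^] int (m div 2) \<otimes> b [^] int (p div 2) \<otimes> c [^] k)"
  unfolding conj_norm_def
proof (rule INF_greatest, clarify)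
  fix xs
  assume xs: "set xs \<subseteq> conj_set G {a, b}"
    "foldr (\<otimes>) xs \<one> = a [^] int (m div 2) \<otimes> b [^] int (p div 2) \<otimes> c [^] k"
  obtain i j where ij: "[\<alpha> (foldr (\<otimes>) xs \<one>) = i] (mod int m)" "[\<beta> (foldr (\<otimes>) xs \<one>) = j] (mod int p)"
    "\<bar>i\<bar> + \<bar>j\<bar> \<le> int (length xs)"
    using foldr_generators_exponents[OF xs(1)] by blast
  have "[i = int (m div 2)] (mod int m)"
    using ij(1) \<alpha>_normal_form unfolding xs(2) by (metis cong_sym cong_trans)
  moreover have "[j = int (p div 2)] (mod int p)"
    using ij(2) \<beta>_normal_form unfolding xs(2) by (metis cong_sym cong_trans)
  ultimately show "enat (m div 2 + p div 2) \<le> enat (length xs)"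
    using ij(3) le_abs_if_cong_half[of i m] le_abs_if_cong_half[of j p] by simp
qed

lemma conj_diameter_eq: "conj_diameter G = enat (m div 2 + p div 2)"
proof (rule antisym)
  show "conj_diameter G \<le> enat (m div 2 + p div 2)"
    unfolding conj_diameter_def by (rule SUP_least) (simp add: group_conj_norm_le)
  have "enat (m div 2 + p div 2)
      \<le> conj_norm G {a, b} (a [^] int (m div 2) \<otimes> b [^] int (p div 2) \<otimes> c [^] (0::int))"
    by (rule conj_norm_generators_ge)
  also have "\<dots> \<le> group_conj_norm G {a, b}"
    unfolding group_conj_norm_def by (intro SUP_upper) simp
  also have "\<dots> \<le> conj_diameter G"
    unfolding conj_diameter_def
    by (intro SUP_upper) (simp add: normally_generates_if_generate generated)
  finally show "enat (m div 2 + p div 2) \<le> conj_diameter G" .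
qed

end

section \<open>Exponent sums in presented groups\<close>

fun letter_exponent :: "('x \<Rightarrow> int) \<Rightarrow> 'x letter \<Rightarrow> int" where
  "letter_exponent f (Gen x) = f x"
| "letter_exponent f (InvGen x) = - f x"

text \<open>On words, this is the homomorphism from the free group to the integers that extends
  \<open>f\<close>.\<close>

definition exponent_sum :: "('x \<Rightarrow> int) \<Rightarrow> 'x letter list \<Rightarrow> int" where
  "exponent_sum f u = (\<Sum>l\<leftarrow>u. letter_exponent f l)"

lemma exponent_sum_simps [simp]:
  "exponent_sum f [] = 0"
  "exponent_sum f (l # u) = letter_exponent f l + exponent_sum f u"
  "exponent_sum f (u @ v) = exponent_sum f u + exponent_sum f v"
  "exponent_sum f (replicate k l) = int k * letter_exponent f l"
  by (simp_all add: exponent_sum_def sum_list_replicate)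

text \<open>Free cancellation preserves exponent sums and concatenation adds them, so only the
  defining relations have to be checked.\<close>

lemma pres_eq_exponent_sum:
  assumes "pres_eq R u v" "\<And>u v. (u, v) \<in> R \<Longrightarrow> [exponent_sum f u = exponent_sum f v] (mod k)"
  shows "[exponent_sum f u = exponent_sum f v] (mod k)"
  using assms(1)
proof induction
  case (sym u v)
  then show ?case by (simp add: cong_sym)
next
  case (trans u v w)
  then show ?case using cong_trans by blast
next
  case (cong u u' v v')
  then show ?case by (simp add: cong_add)
qed (use assms(2) in auto)

text \<open>An arbitrary representative is used; the value is meaningful modulo any \<open>k\<close>
  for which the defining relations balance.\<close>

definition class_exponent_sum :: "('x \<Rightarrow> int) \<Rightarrow> 'x letter list set \<Rightarrow> int" where
  "class_exponent_sum f A = exponent_sum f (SOME u. u \<in> A)"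

lemma class_exponent_sum_word_class:
  assumes "\<And>u v. (u, v) \<in> R \<Longrightarrow> [exponent_sum f u = exponent_sum f v] (mod k)"
  shows "[class_exponent_sum f (word_class R u) = exponent_sum f u] (mod k)"
proof -
  have "u \<in> word_class R u" by (simp add: word_class_def pres_eq.refl)
  then have "(SOME v. v \<in> word_class R u) \<in> word_class R u" by (rule someI)
  then have "pres_eq R u (SOME v. v \<in> word_class R u)" by (simp add: word_class_def)
  from pres_eq_exponent_sum[OF this assms] show ?thesis
    unfolding class_exponent_sum_def by (rule cong_sym)
qed

lemma carrier_presented_group: "carrier (presented_group R) = range (word_class R)"
  by (simp add: presented_group_def)

lemma one_presented_group: "\<one>\<^bsub>presented_group R\<^esub> = word_class R []"
  by (simp add: presented_group_def)

lemma additive_mod_class_exponent_sum: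
  assumes R: "\<And>u v. (u, v) \<in> R \<Longrightarrow> [exponent_sum f u = exponent_sum f v] (mod k)"
  shows "group.additive_mod (presented_group R) k (class_exponent_sum f)"
  unfolding group.additive_mod_def[OF group_presented_group] carrier_presented_group
proof (clarify)
  fix u v
  note class_sum = class_exponent_sum_word_class[OF R]
  have "[class_exponent_sum f (word_class R (u @ v)) = exponent_sum f u + exponent_sum f v] (mod k)"
    using class_sum[where u = "u @ v"] by simp
  also have "[exponent_sum f u + exponent_sum f v
      = class_exponent_sum f (word_class R u) + class_exponent_sum f (word_class R v)] (mod k)"
    by (intro cong_add cong_sym[OF class_sum])
  finally show "[class_exponent_sum f (word_class R u \<otimes>\<^bsub>presented_group R\<^esub> word_class R v)
      = class_exponent_sum f (word_class R u) + class_exponent_sum f (word_class R v)] (mod k)"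
    unfolding presented_group_mult .
qed

section \<open>Generators of a presented group\<close>

lemma inv_presented_group_Gen:
  "inv\<^bsub>presented_group R\<^esub> (word_class R [Gen x]) = word_class R [InvGen x]"
  by (rule group.inv_equality[OF group_presented_group])
    (auto simp: presented_group_mult one_presented_group carrier_presented_group word_class_eq_iff
      intro: pres_eq.cancel_left)

lemma pow_presented_group_Gen:
  "word_class R [l] [^]\<^bsub>presented_group R\<^esub> (k::nat) = word_class R (replicate k l)"
proof (induction k)
  case (Suc k)
  then show ?case
    by (simp add: presented_group_mult replicate_append_same)
qed (simp add: one_presented_group)

lemma generate_presented_group:
  "generate (presented_group R) (range (\<lambda>x. word_class R [Gen x])) = carrier (presented_group R)"
proof -
  interpret group "presented_group R" by (rule group_presented_group)
  let ?H = "generate (presented_group R) (range (\<lambda>x. word_class R [Gen x]))"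
  have "word_class R u \<in> ?H" for u
  proof (induction u)
    case Nil
    show ?case using generate.one[of "presented_group R"] by (simp add: one_presented_group)
  next
    case (Cons l u)
    have "word_class R [l] \<in> ?H"
    proof (cases l)
      case (InvGen x)
      then show ?thesis
        using generate.inv[of "word_class R [Gen x]" _ "presented_group R"]
        by (auto simp flip: inv_presented_group_Gen)
    qed (auto intro: generate.incl)
    from generate.eng[OF this Cons] show ?case by (simp add: presented_group_mult)
  qed
  then show ?thesis
    using generate_incl[of "range (\<lambda>x. word_class R [Gen x])"]
    by (auto simp: carrier_presented_group)
qed

section \<open>The modular group\<close>

text \<open>The relations hold by construction, and the coordinates \<alpha> and \<beta> are the
  exponent sums of the two generators. From \<open>n \<ge> 3\<close> it follows that
  \<open>p\<close> divides \<open>m\<close>.\<close>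

lemma modular_relations_modular_group:
  fixes n p :: nat
  assumes "prime p" "n \<ge> 3"
  shows "\<exists>a b \<alpha> \<beta>. modular_relations (modular_group n p) a b p (p ^ (n - 2)) (n - 2) \<alpha> \<beta>"
proof -
  define m where "m = p ^ (n - 2)"
  define R where "R = {(replicate (p * m) (Gen gen_a), []), (replicate p (Gen gen_b), []),
     ([InvGen gen_b, Gen gen_a, Gen gen_b], replicate (1 + m) (Gen gen_a))}"
  have exp: "p ^ (n - 1) = p * m"
    using assms(2) by (simp add: m_def Suc_diff_Suc numeral_eq_Suc flip: power_Suc)
  have G: "modular_group n p = presented_group R"
    unfolding modular_group_def R_def exp by (simp add: m_def)
  define a b where "a = word_class R [Gen gen_a]" and "b = word_class R [Gen gen_b]"
  define f g :: "gen_ab \<Rightarrow> int" where "f x = of_bool (x = gen_a)" and "g x = of_bool (x = gen_b)" for x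
  \<comment> \<open>The two sides of the three relations differ in their exponent sum of
    \<open>a\<close> by \<open>p * m\<close>, 0 and \<open>m\<close>, and in that of
    \<open>b\<close> by 0, \<open>p\<close> and 0.\<close>
  have f_R: "[exponent_sum f u = exponent_sum f v] (mod int m)" if "(u, v) \<in> R" for u v
    using that by (auto simp: R_def f_def cong_iff_dvd_diff)
  have p_m: "int p dvd int m"
    using assms(2) by (simp add: m_def)
  have g_R: "[exponent_sum g u = exponent_sum g v] (mod int p)" if "(u, v) \<in> R" for u v
    using that by (auto simp: R_def g_def cong_iff_dvd_diff)
  interpret group "presented_group R" by (rule group_presented_group)
  have "modular_relations (presented_group R) a b p m (n - 2) (class_exponent_sum f) (class_exponent_sum g)"
  proof unfold_locales
    show "a [^]\<^bsub>presented_group R\<^esub> (p * m) = \<one>\<^bsub>presented_group R\<^esub>"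
      "b [^]\<^bsub>presented_group R\<^esub> p = \<one>\<^bsub>presented_group R\<^esub>"
      unfolding a_def b_def pow_presented_group_Gen one_presented_group word_class_eq_iff
      by (auto simp: R_def intro: pres_eq.rel)
    show "inv\<^bsub>presented_group R\<^esub> b \<otimes>\<^bsub>presented_group R\<^esub> a \<otimes>\<^bsub>presented_group R\<^esub> b
        = a [^]\<^bsub>presented_group R\<^esub> (1 + m)"
      unfolding a_def b_def pow_presented_group_Gen inv_presented_group_Gen presented_group_mult
        word_class_eq_iff
      by (intro pres_eq.rel) (simp add: R_def)
    have "range (\<lambda>x. word_class R [Gen x]) = {a, b}"
    proof -
      have UNIV_eq: "UNIV = {gen_a, gen_b}" using gen_ab.exhaust by auto
      show ?thesis unfolding UNIV_eq by (simp add: a_def b_def)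
    qed
    then show "generate (presented_group R) {a, b} = carrier (presented_group R)"
      using generate_presented_group[of R] by simp
    show "additive_mod (int m) (class_exponent_sum f)" "additive_mod (int p) (class_exponent_sum g)"
      by (intro additive_mod_class_exponent_sum f_R g_R; assumption)+
    show "[class_exponent_sum f a = 1] (mod int m)" "[class_exponent_sum f b = 0] (mod int m)"
      using class_exponent_sum_word_class[OF f_R, where u = "[Gen gen_a]"]
        class_exponent_sum_word_class[OF f_R, where u = "[Gen gen_b]"]
      by (simp_all add: a_def b_def f_def)
    show "[class_exponent_sum g a = 0] (mod int p)" "[class_exponent_sum g b = 1] (mod int p)"
      using class_exponent_sum_word_class[OF g_R, where u = "[Gen gen_a]"]
        class_exponent_sum_word_class[OF g_R, where u = "[Gen gen_b]"]
      by (simp_all add: a_def b_def g_def)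
  qed (use assms in \<open>auto simp: a_def b_def m_def carrier_presented_group\<close>)
  then show ?thesis unfolding G m_def by blast
qed

theorem theorem1p6:
  fixes p n :: nat
  assumes "prime p"
    and "p = 2 \<Longrightarrow> n \<ge> 4"
    and "odd p \<Longrightarrow> n \<ge> 3"
  shows "ereal_of_enat (conj_diameter (modular_group n p)) =
    ereal (if p = 2 then 2 ^ (n - 3) + 1 else (real p ^ (n - 2) + real p - 2) / 2)"
proof -
  have odd: "odd p" if "p \<noteq> 2"
    using that assms(1) prime_odd_nat prime_ge_2_nat[OF assms(1)] by force
  have n: "n \<ge> 3" using assms(2,3) odd by fastforce
  obtain a b \<alpha> \<beta> where
    "modular_relations (modular_group n p) a b p (p ^ (n - 2)) (n - 2) \<alpha> \<beta>"
    using modular_relations_modular_group[OF assms(1) n] by blast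
  then have diameter: "conj_diameter (modular_group n p) = enat (p ^ (n - 2) div 2 + p div 2)"
    by (rule modular_relations.conj_diameter_eq)
  \<comment> \<open>For odd \<open>p\<close> both \<open>p\<close> and \<open>p ^ (n - 2)\<close>
    are odd, and each rounding down costs 1/2; this accounts for the \<open>- 2\<close> in the
    numerator.\<close>
  have half: "real (k div 2) = (real k - 1) / 2" if "odd k" for k :: nat
    using that by (auto elim!: oddE)
  show ?thesis
  proof (cases "p = 2")
    case True
    \<comment> \<open>This exposes a factor 2, so halving the power is exact; the summand 1 is
      \<open>p div 2\<close>.\<close>
    have "n - 2 = Suc (n - 3)" using n by simp
    then have "p ^ (n - 2) div 2 + p div 2 = 2 ^ (n - 3) + 1" by (simp add: True)
    then show ?thesis unfolding diameter by (simp add: True)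
  next
    case False
    then show ?thesis using odd by (simp add: diameter half field_simps)
  qed
qed

end
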